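(* Suppose $n,m\ge 2$ and $\alpha,k\in\mathbb{N}_0$. Let $Y_\ell(\omega_1)$ and $Y_j(\omega_2)$ be ordinary spherical harmonics of degree $\ell$ on $\mathbb{S}^{n-1}$ and degree $j$ on $\mathbb{S}^{m-1}$, respectively, where $\ell$ and $j$ are non-negative integers satisfying $$\widetilde{k}:=\frac{k-\ell-j(\alpha+1)}{2(\alpha+1)}\in\mathbb{N}_0.$$ Then the function $$u_k=\rho^k h_{k,\ell,j}(\phi)Y_\ell(\omega_1)Y_j(\omega_2),\qquad h_{k,\ell,j}(\phi)=\cos^j\phi\,\sin^{\frac{\ell}{\alpha+1}}\phi\,P_{\widetilde{k}}^{(\mu,\gamma-1)}(\cos2\phi),$$ with $\gamma=j+\frac m2$ and $\mu=\frac{n-2+2\ell}{2(\alpha+1)}$, is a homogeneous Grushin-harmonic polynomial of $\delta_\lambda$-degree $k$ on $\mathbb{R}^{n+m}$.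
   Context: $\mathbb{N}_0=\{0,1,2,\dots\}$. Points of $\mathbb{R}^{n+m}$ are $(x,y)$, $x\in\mathbb{R}^n$, $y\in\mathbb{R}^m$. Polar coordinates $(\rho,\phi,\omega_1,\omega_2)$: $\rho=\left(|x|^{2(\alpha+1)}+(\alpha+1)^2|y|^2\right)^{\frac{1}{2(\alpha+1)}}$, $\phi\in[0,\pi/2]$ is determined by $|x|=\rho\sin^{\frac1{\alpha+1}}\phi$ and $|y|=\frac{1}{\alpha+1}\rho^{\alpha+1}\cos\phi$, and $\omega_1=x/|x|\in\mathbb{S}^{n-1}$, $\omega_2=y/|y|\in\mathbb{S}^{m-1}$. $P_N^{(a,b)}$ denotes the Jacobi polynomial of degree $N$ (standard normalization $P_N^{(a,b)}(1)=(a+1)_N/N!$). A function $u$ is homogeneous of $\delta_\lambda$-degree $k$ if $u(\lambda x,\lambda^{\alpha+1}y)=\lambda^ku(x,y)$ for all $\lambda>0$. $u$ is Grushin-harmonic if $\Delta_\alpha u=0$, where $\Delta_\alpha=\Delta_x+|x|^{2\alpha}\Delta_y$. *)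

theory Defs
  imports "HOL-Analysis.Analysis"
begin

definition partial_deriv :: "'a::real_normed_vector \<Rightarrow> ('a \<Rightarrow> 'b::real_normed_vector) \<Rightarrow> 'a \<Rightarrow> 'b" where
  "partial_deriv b f x = vector_derivative (\<lambda>t. f (x + t *\<^sub>R b)) (at 0)"

definition laplacian :: "('a::euclidean_space \<Rightarrow> 'b::real_normed_vector) \<Rightarrow> 'a \<Rightarrow> 'b" where
  "laplacian f x = (\<Sum>b\<in>Basis. partial_deriv b (partial_deriv b f) x)"

definition grushin_laplacian ::
  "nat \<Rightarrow> ('a::euclidean_space \<times> 'c::euclidean_space \<Rightarrow> 'b::real_normed_vector) \<Rightarrow> 'a \<times> 'c \<Rightarrow> 'b" where
  "grushin_laplacian \<alpha> u = (\<lambda>(x, y).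
     laplacian (\<lambda>x'. u (x', y)) x + norm x ^ (2 * \<alpha>) *\<^sub>R laplacian (\<lambda>y'. u (x, y')) y)"

definition grushin_harmonic ::
  "nat \<Rightarrow> ('a::euclidean_space \<times> 'c::euclidean_space \<Rightarrow> 'b::real_normed_vector) \<Rightarrow> bool" where
  "grushin_harmonic \<alpha> u \<longleftrightarrow> (\<forall>z. grushin_laplacian \<alpha> u z = 0)"

definition grushin_homogeneous ::
  "nat \<Rightarrow> nat \<Rightarrow> ('a::euclidean_space \<times> 'c::euclidean_space \<Rightarrow> 'b::real_normed_vector) \<Rightarrow> bool" where
  "grushin_homogeneous \<alpha> k u \<longleftrightarrow>
     (\<forall>c>0. \<forall>x y. u (c *\<^sub>R x, c ^ (\<alpha> + 1) *\<^sub>R y) = c ^ k *\<^sub>R u (x, y))"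

text \<open>A spherical harmonic of degree \<open>l\<close> is the restriction to the unit sphere of a harmonic
  polynomial that is homogeneous of degree \<open>l\<close>. Values of \<open>Y\<close> off the sphere are irrelevant.\<close>

definition spherical_harmonic ::
  "nat \<Rightarrow> ('a::euclidean_space \<Rightarrow> 'b::real_normed_vector) \<Rightarrow> bool" where
  "spherical_harmonic l Y \<longleftrightarrow>
     (\<exists>H. polynomial_function H \<and> (\<forall>c x. H (c *\<^sub>R x) = c ^ l *\<^sub>R H x) \<and>
          (\<forall>x. laplacian H x = 0) \<and> (\<forall>\<omega>\<in>sphere 0 1. Y \<omega> = H \<omega>))"

text \<open>The Jacobi polynomial of degree \<open>N\<close> with parameters \<open>a\<close>, \<open>b\<close>, by the classical explicit
  formula (Szego, Orthogonal Polynomials, (4.3.2)).\<close>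

definition jacobi_poly :: "nat \<Rightarrow> real \<Rightarrow> real \<Rightarrow> real \<Rightarrow> real" where
  "jacobi_poly N a b t = (\<Sum>s\<le>N. ((real N + a) gchoose (N - s)) * ((real N + b) gchoose s) *
     ((t - 1) / 2) ^ s * ((t + 1) / 2) ^ (N - s))"

lemma jacobi_poly_at_1: "jacobi_poly N a b 1 = pochhammer (a + 1) N / fact N"
proof -
  have "jacobi_poly N a b 1 = (\<Sum>s\<in>{0}. ((real N + a) gchoose (N - s)) * ((real N + b) gchoose s) *
     ((1 - 1) / 2) ^ s * ((1 + 1) / 2) ^ (N - s))"
    unfolding jacobi_poly_def by (rule sum.mono_neutral_right) auto
  then show ?thesis
    by (simp add: gbinomial_pochhammer')
qed

definition grushin_rho :: "nat \<Rightarrow> 'a::euclidean_space \<Rightarrow> 'c::euclidean_space \<Rightarrow> real" where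
  "grushin_rho \<alpha> x y =
     root (2 * (\<alpha> + 1)) (norm x ^ (2 * (\<alpha> + 1)) + (real \<alpha> + 1)\<^sup>2 * (norm y)\<^sup>2)"

text \<open>\<open>(\<rho>, \<phi>, \<omega>\<^sub>1, \<omega>\<^sub>2)\<close> are polar coordinates of \<open>(x, y)\<close>. They are unique when \<open>x\<close> and \<open>y\<close>
  are both nonzero; then \<open>\<omega>\<^sub>1 = x / |x|\<close> and \<open>\<omega>\<^sub>2 = y / |y|\<close>. At the other points the angles that
  are not determined may be chosen arbitrarily. The power of \<open>sin \<phi>\<close> with exponent \<open>1 / (\<alpha> + 1)\<close>
  is written with \<open>root\<close>.\<close>

definition grushin_polar ::
  "nat \<Rightarrow> 'a::euclidean_space \<Rightarrow> 'c::euclidean_space \<Rightarrow> real \<Rightarrow> real \<Rightarrow> 'a \<Rightarrow> 'c \<Rightarrow> bool" where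
  "grushin_polar \<alpha> x y \<rho> \<phi> \<omega>1 \<omega>2 \<longleftrightarrow>
     \<rho> = grushin_rho \<alpha> x y \<and> \<phi> \<in> {0..pi/2} \<and>
     norm x = \<rho> * root (\<alpha> + 1) (sin \<phi>) \<and>
     norm y = 1 / (real \<alpha> + 1) * \<rho> ^ (\<alpha> + 1) * cos \<phi> \<and>
     \<omega>1 \<in> sphere 0 1 \<and> \<omega>2 \<in> sphere 0 1 \<and>
     x = norm x *\<^sub>R \<omega>1 \<and> y = norm y *\<^sub>R \<omega>2"

text \<open>Every point has polar coordinates, so a function is determined by its values in them.\<close>

lemma grushin_polar_exists:
  fixes x :: "'a::euclidean_space" and y :: "'c::euclidean_space"
  shows "\<exists>\<rho> \<phi> \<omega>1 \<omega>2. grushin_polar \<alpha> x y \<rho> \<phi> \<omega>1 \<omega>2"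
proof -
  define r where "r = grushin_rho \<alpha> x y"
  define A where "A = norm x ^ (\<alpha> + 1)"
  define B where "B = (real \<alpha> + 1) * norm y"
  have AB: "A \<ge> 0" "B \<ge> 0" by (auto simp: A_def B_def)
  have dir: "\<exists>w\<in>sphere 0 1. z = norm z *\<^sub>R w" for z :: "'d::euclidean_space"
  proof (cases "z = 0")
    case True
    then show ?thesis using SOME_Basis by (intro bexI[of _ "SOME b. b \<in> Basis"]) auto
  next
    case False
    then show ?thesis by (intro bexI[of _ "sgn z"]) (auto simp: norm_sgn sgn_div_norm)
  qed
  have r0: "r \<ge> 0" by (simp add: r_def grushin_rho_def)
  have "r ^ (2 * (\<alpha> + 1)) = norm x ^ (2 * (\<alpha> + 1)) + (real \<alpha> + 1)\<^sup>2 * (norm y)\<^sup>2"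
    unfolding r_def grushin_rho_def by (rule real_root_pow_pos2) auto
  moreover have "norm x ^ (2 * (\<alpha> + 1)) = A\<^sup>2"
    unfolding A_def by (subst power_mult [symmetric]) (simp add: mult.commute)
  moreover have "r ^ (2 * (\<alpha> + 1)) = (r ^ (\<alpha> + 1))\<^sup>2"
    by (subst power_mult [symmetric]) (simp add: mult.commute)
  ultimately have eq: "(r ^ (\<alpha> + 1))\<^sup>2 = A\<^sup>2 + B\<^sup>2"
    by (simp add: B_def power_mult_distrib)
  have "\<exists>\<phi>\<in>{0..pi/2}. norm x = r * root (\<alpha> + 1) (sin \<phi>) \<and>
      norm y = 1 / (real \<alpha> + 1) * r ^ (\<alpha> + 1) * cos \<phi>"
  proof (cases "r = 0")
    case True
    then have "A = 0" "B = 0" using eq by (auto simp: sum_power2_eq_zero_iff)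
    then have "norm x = 0" "norm y = 0" by (auto simp: A_def B_def)
    then show ?thesis using True by (intro bexI[of _ 0]) auto
  next
    case False
    define R where "R = r ^ (\<alpha> + 1)"
    have R: "R > 0" using False r0 by (simp add: R_def)
    have eqR: "R\<^sup>2 = A\<^sup>2 + B\<^sup>2" using eq by (simp add: R_def)
    have "(A / R)\<^sup>2 + (B / R)\<^sup>2 = 1"
      using R unfolding power_divide add_divide_distrib [symmetric] eqR [symmetric] by simp
    then obtain t where t: "0 \<le> t" "t \<le> pi / 2" "B / R = cos t" "A / R = sin t"
      using sincos_total_pi_half[of "B / R" "A / R"] AB R by (auto simp: add.commute)
    have "root (\<alpha> + 1) (sin t) = root (\<alpha> + 1) ((norm x / r) ^ (\<alpha> + 1))"
      using t(4) by (simp only: A_def R_def power_divide)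
    also have "\<dots> = norm x / r" using r0 by (intro real_root_power_cancel) auto
    finally have "norm x = r * root (\<alpha> + 1) (sin t)" using False by simp
    moreover have "1 / (real \<alpha> + 1) * r ^ (\<alpha> + 1) * cos t = norm y"
      using R unfolding R_def [symmetric] t(3) [symmetric] by (simp add: B_def)
    ultimately show ?thesis using t by (intro bexI[of _ t]) auto
  qed
  then show ?thesis
    using dir[of x] dir[of y] unfolding grushin_polar_def r_def by blast
qed

text \<open>\<open>N\<close> is the degree of the Jacobi polynomial. The power of \<open>sin \<phi>\<close> with exponent
  \<open>l / (\<alpha> + 1)\<close> is written with \<open>root\<close> because it has to be \<open>1\<close> for \<open>l = 0\<close> also at \<open>\<phi> = 0\<close>,
  whereas \<open>0 powr 0 = 0\<close>.\<close>

definition grushin_h :: "nat \<Rightarrow> nat \<Rightarrow> nat \<Rightarrow> nat \<Rightarrow> real \<Rightarrow> real \<Rightarrow> real \<Rightarrow> real" where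
  "grushin_h \<alpha> N l j \<mu> \<gamma> \<phi> =
     cos \<phi> ^ j * root (\<alpha> + 1) (sin \<phi>) ^ l * jacobi_poly N \<mu> (\<gamma> - 1) (cos (2 * \<phi>))"

end

theory Submission
  imports Defs
begin

text \<open>Write \<open>a = \<alpha> + 1\<close>. Since \<open>\<rho>\<^bsup>a\<^esup> cos \<phi> = a |y|\<close> and \<open>\<rho>\<^bsup>a\<^esup> sin \<phi> = |x|\<^bsup>a\<^esup>\<close>, Szego's
  formula for the Jacobi polynomial turns \<open>u\<^sub>k\<close> into a combination of the terms
  \<open>|x|\<^bsup>2as\<^esup> |y|\<^bsup>2(N - s)\<^esup> H\<^sub>1(x) H\<^sub>2(y)\<close>, where \<open>H\<^sub>1\<close> and \<open>H\<^sub>2\<close> are the solid harmonics of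
  \<open>Y\<^sub>\<ell>\<close> and \<open>Y\<^sub>j\<close>. By Euler's identity
  \<open>\<Delta>(|x|\<^bsup>2p\<^esup> H) = 2p (2p + n - 2 + 2\<ell>) |x|\<^bsup>2p - 2\<^esup> H\<close> for a solid harmonic of degree
  \<open>\<ell>\<close> on an \<open>n\<close>-dimensional space, so the \<open>x\<close>-part of the operator applied to the term \<open>s + 1\<close> and
  the \<open>y\<close>-part applied to the term \<open>s\<close> are multiples of the same function; the coefficients
  of the Jacobi polynomial make them cancel.\<close>

subsection \<open>Partial derivatives of polynomial functions\<close>

text \<open>\<open>vector_derivative\<close> is a description, so its value is known only once a
  derivative has been exhibited; the chain rule along the line through \<open>x\<close> in direction
  \<open>b\<close> exhibits one.\<close>

lemma partial_deriv_eq: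
  assumes "(f has_derivative f') (at x)"
  shows "partial_deriv b f x = f' b"
proof -
  interpret f': bounded_linear f'
    using assms by (rule has_derivative_bounded_linear)
  have "((\<lambda>t. x + t *\<^sub>R b) has_derivative (\<lambda>t. t *\<^sub>R b)) (at 0)"
    by (auto intro!: derivative_eq_intros)
  then have "((\<lambda>t. f (x + t *\<^sub>R b)) has_derivative (\<lambda>t. f' (t *\<^sub>R b))) (at 0)"
    using has_derivative_compose[of "\<lambda>t. x + t *\<^sub>R b" "\<lambda>t. t *\<^sub>R b" 0 UNIV f f'] assms
    by simp
  then show ?thesis
    unfolding partial_deriv_def
    by (intro vector_derivative_at) (simp add: has_vector_derivative_def f'.scaleR)
qed

text \<open>Induction on the formation of polynomials. That every directional derivative is
  polynomial again is carried along, because the Laplacian differentiates twice.\<close>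

lemma real_polynomial_function_has_derivative:
  assumes "real_polynomial_function f"
  shows "\<exists>f'. (\<forall>x. (f has_derivative f' x) (at x)) \<and> (\<forall>b. real_polynomial_function (\<lambda>x. f' x b))"
  using assms
proof (induction rule: real_polynomial_function.induct)
  case (linear f)
  then show ?case
    by (intro exI[of _ "\<lambda>_. f"])
       (simp add: bounded_linear_imp_has_derivative real_polynomial_function.intros(2))
next
  case (const c)
  then show ?case
    by (intro exI[of _ "\<lambda>_ _. 0"]) (simp add: real_polynomial_function.intros(2))
next
  case (add f g)
  then obtain f' g' where
    "\<And>x. (f has_derivative f' x) (at x)" "\<And>b. real_polynomial_function (\<lambda>x. f' x b)"
    "\<And>x. (g has_derivative g' x) (at x)" "\<And>b. real_polynomial_function (\<lambda>x. g' x b)"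
    by blast
  then show ?case
    by (intro exI[of _ "\<lambda>x b. f' x b + g' x b"])
       (simp add: has_derivative_add real_polynomial_function.intros(3))
next
  case (mult f g)
  then obtain f' g' where
    "\<And>x. (f has_derivative f' x) (at x)" "\<And>b. real_polynomial_function (\<lambda>x. f' x b)"
    "\<And>x. (g has_derivative g' x) (at x)" "\<And>b. real_polynomial_function (\<lambda>x. g' x b)"
    by blast
  with mult.hyps show ?case
    by (intro exI[of _ "\<lambda>x b. f x * g' x b + f' x b * g x"])
       (simp add: has_derivative_mult real_polynomial_function.intros(3,4))
qed

text \<open>Reduces to the real-valued components and puts their derivatives together again over
  \<open>Basis\<close>.\<close>

lemma polynomial_function_has_derivative:
  fixes f :: "'a::real_normed_vector \<Rightarrow> 'b::euclidean_space"
  assumes "polynomial_function f"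
  shows "\<exists>f'. (\<forall>x. (f has_derivative f' x) (at x)) \<and> (\<forall>b. polynomial_function (\<lambda>x. f' x b))"
proof -
  have "\<forall>i\<in>Basis. \<exists>f'. (\<forall>x. ((\<lambda>x. f x \<bullet> i) has_derivative f' x) (at x)) \<and>
      (\<forall>b. real_polynomial_function (\<lambda>x. f' x b))"
    using assms real_polynomial_function_has_derivative
    unfolding polynomial_function_iff_Basis_inner by blast
  then obtain f' where f': "\<And>i x. i \<in> Basis \<Longrightarrow> ((\<lambda>x. f x \<bullet> i) has_derivative f' i x) (at x)"
    "\<And>i b. i \<in> Basis \<Longrightarrow> real_polynomial_function (\<lambda>x. f' i x b)"
    by metis
  have "((\<lambda>x. \<Sum>i\<in>Basis. (f x \<bullet> i) *\<^sub>R i) has_derivative (\<lambda>b. \<Sum>i\<in>Basis. f' i x b *\<^sub>R i)) (at x)" for x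
    by (intro has_derivative_sum has_derivative_scaleR_left f')
  moreover have "polynomial_function (\<lambda>x. \<Sum>i\<in>Basis. f' i x b *\<^sub>R i)" for b
    using f'(2)
    by (intro polynomial_function_sum polynomial_function_mult)
       (auto simp: real_polynomial_function_eq)
  ultimately show ?thesis
    by (intro exI[of _ "\<lambda>x b. \<Sum>i\<in>Basis. f' i x b *\<^sub>R i"]) (simp add: euclidean_representation)
qed

lemma
  fixes f :: "'a::real_normed_vector \<Rightarrow> 'b::euclidean_space"
  assumes "polynomial_function f"
  shows polynomial_function_has_derivative_partial_deriv:
      "(f has_derivative (\<lambda>b. partial_deriv b f x)) (at x)"
    and polynomial_function_partial_deriv: "polynomial_function (partial_deriv b f)"
proof -
  obtain f' where f': "\<And>x. (f has_derivative f' x) (at x)"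
      "\<And>b. polynomial_function (\<lambda>x. f' x b)"
    using polynomial_function_has_derivative[OF assms] by blast
  have eq: "partial_deriv b f = (\<lambda>x. f' x b)" for b
    by (rule ext, rule partial_deriv_eq, rule f'(1))
  show "(f has_derivative (\<lambda>b. partial_deriv b f x)) (at x)"
    using f'(1)[of x] by (simp add: eq)
  show "polynomial_function (partial_deriv b f)"
    using f'(2) by (simp add: eq)
qed

text \<open>Here and in the next three rules the equation is between functions, not values at a
  point, so that it can rewrite the inner \<open>partial_deriv\<close> of a second
  derivative.\<close>

lemma partial_deriv_bounded_linear:
  fixes f :: "'a::real_normed_vector \<Rightarrow> 'b::euclidean_space"
  assumes "bounded_linear L" "polynomial_function f"
  shows "partial_deriv b (\<lambda>x. L (f x)) = (\<lambda>x. L (partial_deriv b f x))"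
  by (rule ext, rule partial_deriv_eq[OF bounded_linear.has_derivative[OF assms(1)
        polynomial_function_has_derivative_partial_deriv[OF assms(2)]]])

lemma partial_deriv_sum:
  fixes f :: "'i \<Rightarrow> 'a::real_normed_vector \<Rightarrow> 'b::euclidean_space"
  assumes "\<And>i. i \<in> I \<Longrightarrow> polynomial_function (f i)"
  shows "partial_deriv b (\<lambda>x. \<Sum>i\<in>I. f i x) = (\<lambda>x. \<Sum>i\<in>I. partial_deriv b (f i) x)"
  by (rule ext, rule partial_deriv_eq[OF has_derivative_sum[OF
        polynomial_function_has_derivative_partial_deriv[OF assms]]])

lemma partial_deriv_add:
  fixes f g :: "'a::real_normed_vector \<Rightarrow> 'b::euclidean_space"
  assumes "polynomial_function f" "polynomial_function g"
  shows "partial_deriv b (\<lambda>x. f x + g x) = (\<lambda>x. partial_deriv b f x + partial_deriv b g x)"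
  by (rule ext, rule partial_deriv_eq[OF has_derivative_add[OF
        assms[THEN polynomial_function_has_derivative_partial_deriv]]])

lemma partial_deriv_scaleR:
  fixes r :: "'a::real_normed_vector \<Rightarrow> real" and f :: "'a \<Rightarrow> 'b::euclidean_space"
  assumes "polynomial_function r" "polynomial_function f"
  shows "partial_deriv b (\<lambda>x. r x *\<^sub>R f x) =
    (\<lambda>x. r x *\<^sub>R partial_deriv b f x + partial_deriv b r x *\<^sub>R f x)"
  by (rule ext, rule partial_deriv_eq[OF has_derivative_scaleR[OF
        assms[THEN polynomial_function_has_derivative_partial_deriv]]])

section \<open>Even norm powers and products as polynomial functions\<close>

lemma polynomial_function_norm_power:
  "polynomial_function (\<lambda>x::'a::euclidean_space. norm x ^ (2 * p))"
proof -
  have "real_polynomial_function (\<lambda>x::'a. (\<Sum>i\<in>Basis. (x \<bullet> i) * (x \<bullet> i)) ^ p)"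
    by (intro real_polynomial_function_power real_polynomial_function_sum
          real_polynomial_function.intros(4) real_polynomial_function.intros(1)
          bounded_linear_inner_left finite_Basis)
  then show ?thesis
    by (simp add: real_polynomial_function_eq power_mult power2_norm_eq_inner
          euclidean_inner [symmetric])
qed

text \<open>By bilinearity only the real coefficients vary; the products \<open>i * j\<close> of
  basis elements are constant vectors. This admits complex-valued harmonics as well as real
  ones.\<close>

lemma polynomial_function_times:
  fixes f g :: "'a::real_normed_vector \<Rightarrow> 'b::{real_normed_field, euclidean_space}"
  assumes "polynomial_function f" "polynomial_function g"
  shows "polynomial_function (\<lambda>x. f x * g x)"
proof -
  have eq: "f x * g x = (\<Sum>i\<in>Basis. \<Sum>j\<in>Basis. (f x \<bullet> i) *\<^sub>R (g x \<bullet> j) *\<^sub>R (i * j))" for x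
  proof -
    have "f x * g x = (\<Sum>i\<in>Basis. (f x \<bullet> i) *\<^sub>R i) * (\<Sum>j\<in>Basis. (g x \<bullet> j) *\<^sub>R j)"
      by (simp only: euclidean_representation)
    then show ?thesis
      by (simp add: sum_product mult.commute)
  qed
  show ?thesis
    unfolding eq using assms
    by (intro polynomial_function_sum polynomial_function_mult)
       (auto simp: polynomial_function_iff_Basis_inner[where f = f]
          polynomial_function_iff_Basis_inner[where f = g] real_polynomial_function_eq)
qed

subsection \<open>The Laplacian of polynomial functions\<close>

text \<open>Meant for \<open>L\<close> the multiplication by a factor that depends on the other
  variable only.\<close>

lemma laplacian_bounded_linear:
  fixes f :: "'a::euclidean_space \<Rightarrow> 'b::euclidean_space" and L :: "'b \<Rightarrow> 'c::euclidean_space"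
  assumes "bounded_linear L" "polynomial_function f"
  shows "laplacian (\<lambda>x. L (f x)) x = L (laplacian f x)"
  using assms
  by (simp add: laplacian_def partial_deriv_bounded_linear[OF assms(1)]
        polynomial_function_partial_deriv linear_sum bounded_linear.linear)

lemma laplacian_sum:
  fixes f :: "'i \<Rightarrow> 'a::euclidean_space \<Rightarrow> 'b::euclidean_space"
  assumes "\<And>i. i \<in> I \<Longrightarrow> polynomial_function (f i)"
  shows "laplacian (\<lambda>x. \<Sum>i\<in>I. f i x) x = (\<Sum>i\<in>I. laplacian (f i) x)"
  unfolding laplacian_def using assms
  by (subst sum.swap) (simp add: partial_deriv_sum polynomial_function_partial_deriv)

lemma laplacian_scaleR:
  fixes r :: "'a::euclidean_space \<Rightarrow> real" and f :: "'a \<Rightarrow> 'b::euclidean_space"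
  assumes "polynomial_function r" "polynomial_function f"
  shows "laplacian (\<lambda>x. r x *\<^sub>R f x) x = r x *\<^sub>R laplacian f x
    + 2 *\<^sub>R (\<Sum>b\<in>Basis. partial_deriv b r x *\<^sub>R partial_deriv b f x) + laplacian r x *\<^sub>R f x"
proof -
  have "partial_deriv b (partial_deriv b (\<lambda>x. r x *\<^sub>R f x)) x =
      r x *\<^sub>R partial_deriv b (partial_deriv b f) x
      + 2 *\<^sub>R (partial_deriv b r x *\<^sub>R partial_deriv b f x)
      + partial_deriv b (partial_deriv b r) x *\<^sub>R f x" for b
    using assms
    by (simp add: partial_deriv_scaleR partial_deriv_add polynomial_function_partial_deriv
          polynomial_function_mult algebra_simps) (simp flip: scaleR_2)
  then show ?thesis
    by (simp add: laplacian_def sum.distrib scaleR_sum_right scaleR_sum_left)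
qed

section \<open>Norm powers and solid harmonics under the Laplacian\<close>

text \<open>The proof differentiates \<open>(x \<bullet> x) ^ p\<close>, since \<open>norm\<close>
  has no derivative at 0. The result is a norm power scaling a linear map, ready for the product
  rule. At \<open>p = 0\<close> the truncated \<open>p - 1\<close> is harmless because of the factor
  \<open>real p\<close>.\<close>

lemma partial_deriv_norm_power:
  "partial_deriv b (\<lambda>x::'a::euclidean_space. norm x ^ (2 * p)) =
    (\<lambda>x. norm x ^ (2 * (p - 1)) *\<^sub>R (2 * real p * (x \<bullet> b)))"
proof
  fix x :: 'a
  have "((\<lambda>x::'a. (x \<bullet> x) ^ p) has_derivative
      (\<lambda>b. (x \<bullet> x) ^ (p - 1) * (2 * real p * (x \<bullet> b)))) (at x)"
    by (auto intro!: derivative_eq_intros simp: inner_commute algebra_simps)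
  from partial_deriv_eq[OF this, of b] show "partial_deriv b (\<lambda>x. norm x ^ (2 * p)) x =
      norm x ^ (2 * (p - 1)) *\<^sub>R (2 * real p * (x \<bullet> b))"
    by (simp add: power_mult power2_norm_eq_inner)
qed

lemma laplacian_norm_power:
  "laplacian (\<lambda>x::'a::euclidean_space. norm x ^ (2 * p)) x =
    2 * real p * (2 * real p + real DIM('a) - 2) * norm x ^ (2 * (p - 1))"
proof (cases "p = 0")
  case True
  then show ?thesis
    by (simp add: laplacian_def partial_deriv_def)
next
  case False
  have lin: "bounded_linear (\<lambda>x::'a. 2 * real p * (x \<bullet> b))" for b
    by (intro bounded_linear_mult_right[THEN bounded_linear_compose] bounded_linear_inner_left)
  have plin: "partial_deriv b (\<lambda>x::'a. 2 * real p * (x \<bullet> b)) x = 2 * real p * (b \<bullet> b)" for b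
    by (rule partial_deriv_eq[OF bounded_linear_imp_has_derivative[OF lin]])
  have second: "partial_deriv b (partial_deriv b (\<lambda>x::'a. norm x ^ (2 * p))) x =
      2 * real p * norm x ^ (2 * (p - 1)) +
      4 * real p * real (p - 1) * norm x ^ (2 * (p - 1 - 1)) * ((x \<bullet> b) * (x \<bullet> b))"
    if "b \<in> Basis" for b
  proof -
    \<comment> \<open>\<open>A\<close> and \<open>B\<close> stand for the two norm powers,
      \<open>P\<close> for \<open>p\<close>, \<open>Q\<close> for \<open>p - 1\<close> and
      \<open>z\<close> for \<open>x \<bullet> b\<close>; with variables the truncated exponents stay
      untouched.\<close>
    have rearrange: "A *\<^sub>R (2 * P * 1) + (B *\<^sub>R (2 * Q * z)) *\<^sub>R (2 * P * z) =
        2 * P * A + 4 * P * Q * B * (z * z)" for A B P Q z :: real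
      by (simp add: algebra_simps)
    show ?thesis
      unfolding partial_deriv_norm_power[of b p]
        partial_deriv_scaleR[OF polynomial_function_norm_power
          polynomial_function_bounded_linear[OF lin]]
        plin partial_deriv_norm_power inner_same_Basis[OF that]
      by (rule rearrange)
  qed
  have "laplacian (\<lambda>x::'a. norm x ^ (2 * p)) x =
      2 * real p * norm x ^ (2 * (p - 1)) * real DIM('a) +
      4 * real p * real (p - 1) * norm x ^ (2 * (p - 1 - 1)) * (norm x)\<^sup>2"
    by (simp add: laplacian_def second sum.distrib sum_distrib_left [symmetric]
          euclidean_inner [symmetric] power2_norm_eq_inner)
  \<comment> \<open>For \<open>p = 1\<close> the exponent \<open>p - 1 - 1\<close> is truncated, but
    both sides carry the factor \<open>real (p - 1) = 0\<close>.\<close>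
  also have "real (p - 1) * norm x ^ (2 * (p - 1 - 1)) * (norm x)\<^sup>2 =
      real (p - 1) * norm x ^ (2 * (p - 1))"
    by (cases "p - 1") (auto simp: power_add power2_eq_square)
  then have "4 * real p * real (p - 1) * norm x ^ (2 * (p - 1 - 1)) * (norm x)\<^sup>2 =
      4 * real p * (real (p - 1) * norm x ^ (2 * (p - 1)))"
    by (simp add: mult.assoc)
  finally show ?thesis
    using False by (simp add: of_nat_diff algebra_simps)
qed

text \<open>The sum is the derivative of \<open>H\<close> at \<open>x\<close> in the direction
  \<open>x\<close> itself, and on that line homogeneity reduces \<open>H\<close> to the scalar
  function \<open>(1 + t) ^ l\<close> times \<open>H x\<close>.\<close>

lemma euler_homogeneous:
  fixes H :: "'a::euclidean_space \<Rightarrow> 'b::euclidean_space"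
  assumes H: "polynomial_function H" and hom: "\<And>c x. H (c *\<^sub>R x) = c ^ l *\<^sub>R H x"
  shows "(\<Sum>b\<in>Basis. (x \<bullet> b) *\<^sub>R partial_deriv b H x) = real l *\<^sub>R H x"
proof -
  note D = polynomial_function_has_derivative_partial_deriv[OF H, of x]
  have "(\<Sum>b\<in>Basis. (x \<bullet> b) *\<^sub>R partial_deriv b H x) =
      partial_deriv (\<Sum>b\<in>Basis. (x \<bullet> b) *\<^sub>R b) H x"
    by (simp add: linear_sum[OF has_derivative_linear[OF D]]
          linear_scale[OF has_derivative_linear[OF D]])
  also have "\<dots> = partial_deriv x H x"
    by (simp add: euclidean_representation)
  also have "\<dots> = vector_derivative (\<lambda>t. (1 + t) ^ l *\<^sub>R H x) (at 0)"
  proof -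
    have "H (x + t *\<^sub>R x) = (1 + t) ^ l *\<^sub>R H x" for t
      using hom[of "1 + t" x] by (simp add: scaleR_add_left)
    then show ?thesis
      by (simp add: partial_deriv_def)
  qed
  also have "\<dots> = real l *\<^sub>R H x"
    by (rule vector_derivative_at)
       (auto intro!: derivative_eq_intros simp: has_vector_derivative_def)
  finally show ?thesis .
qed

text \<open>In the product rule the term with \<open>laplacian H\<close> vanishes, and Euler's
  identity turns the gradient term into a multiple of \<open>H\<close>, which accounts for the
  summand \<open>2 * real l\<close>.\<close>

lemma laplacian_norm_power_harmonic:
  fixes H :: "'a::euclidean_space \<Rightarrow> 'b::euclidean_space"
  assumes H: "polynomial_function H" and hom: "\<And>c x. H (c *\<^sub>R x) = c ^ l *\<^sub>R H x"
    and harm: "\<And>x. laplacian H x = 0"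
  shows "laplacian (\<lambda>x. norm x ^ (2 * p) *\<^sub>R H x) x =
    (2 * real p * (2 * real p + real DIM('a) - 2 + 2 * real l) * norm x ^ (2 * (p - 1))) *\<^sub>R H x"
proof -
  have "(\<Sum>b\<in>Basis. partial_deriv b (\<lambda>x. norm x ^ (2 * p)) x *\<^sub>R partial_deriv b H x) =
      (2 * real p * norm x ^ (2 * (p - 1))) *\<^sub>R (\<Sum>b\<in>Basis. (x \<bullet> b) *\<^sub>R partial_deriv b H x)"
    unfolding partial_deriv_norm_power scaleR_sum_right by (simp add: mult_ac)
  then show ?thesis
    by (simp add: laplacian_scaleR polynomial_function_norm_power H harm laplacian_norm_power
          euler_homogeneous[OF H hom] flip: scaleR_add_left) (simp add: algebra_simps)
qed

subsection \<open>The Grushin harmonic polynomial\<close>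

text \<open>The coefficient of \<open>((t - 1) / 2) ^ s * ((t + 1) / 2) ^ (N - s)\<close> in
  \<open>jacobi_poly N a b t\<close>.\<close>

definition jacobi_coeff :: "nat \<Rightarrow> real \<Rightarrow> real \<Rightarrow> nat \<Rightarrow> real" where
  "jacobi_coeff N a b s = ((real N + a) gchoose (N - s)) * ((real N + b) gchoose s)"

lemma gbinomial_Suc_mult:
  "(a gchoose Suc k) * real (Suc k) = (a - real k) * (a gchoose k)" for a :: real
  using gbinomial_mult_1[of a k] by (simp add: algebra_simps)

text \<open>From \<open>s\<close> to \<open>Suc s\<close> each of the two binomials moves by one
  index, in opposite directions. The quotient is cleared of denominators, so \<open>a\<close> and
  \<open>b\<close> may be any reals; up to constants, the factors on the two sides are those that
  the \<open>x\<close>-part and the \<open>y\<close>-part of the operator produce.\<close>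

lemma jacobi_coeff_Suc:
  assumes "s < N"
  shows "jacobi_coeff N a b (Suc s) * (real (Suc s) * (real (Suc s) + a)) =
    jacobi_coeff N a b s * (real (N - s) * (real (N - s) + b))"
proof -
  obtain q where q: "N - s = Suc q" "N - Suc s = q" "real N = real s + real q + 1"
    using assms by (metis Suc_diff_Suc add_Suc_right le_add_diff_inverse less_imp_le
        of_nat_Suc of_nat_add add.commute add.left_commute)
  have 1: "((real N + a) gchoose Suc q) * real (Suc q) = (real (Suc s) + a) * ((real N + a) gchoose q)"
    by (subst gbinomial_Suc_mult) (simp add: q(3))
  have 2: "((real N + b) gchoose Suc s) * real (Suc s) = (real (Suc q) + b) * ((real N + b) gchoose s)"
    by (subst gbinomial_Suc_mult) (simp add: q(3))
  have "jacobi_coeff N a b (Suc s) * (real (Suc s) * (real (Suc s) + a)) =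
      ((real (Suc s) + a) * ((real N + a) gchoose q)) *
      (((real N + b) gchoose Suc s) * real (Suc s))"
    by (simp only: jacobi_coeff_def q mult_ac)
  also have "\<dots> = jacobi_coeff N a b s * (real (N - s) * (real (N - s) + b))"
    unfolding 2 unfolding 1 [symmetric] by (simp only: jacobi_coeff_def q mult_ac)
  finally show ?thesis .
qed

section \<open>The candidate polynomial in Cartesian form and its homogeneity\<close>

text \<open>The sign comes from \<open>(cos (2 * \<phi>) - 1) / 2 = - (sin \<phi>)^2\<close>. The
  power of \<open>real \<alpha> + 1\<close> comes from writing
  \<open>\<rho> ^ (\<alpha> + 1) * cos \<phi>\<close> as
  \<open>(real \<alpha> + 1) * norm y\<close>.\<close>

definition grushin_coeff :: "nat \<Rightarrow> nat \<Rightarrow> nat \<Rightarrow> real \<Rightarrow> real \<Rightarrow> nat \<Rightarrow> real" where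
  "grushin_coeff \<alpha> N j a b s =
     jacobi_coeff N a b s * (- 1) ^ s * (real \<alpha> + 1) ^ (2 * (N - s) + j)"

text \<open>Each term is a product of a function of \<open>x\<close> and a function of
  \<open>y\<close>, both of the form treated in \<open>laplacian_norm_power_harmonic\<close>. The
  norms occur in even powers only, which makes the sum a polynomial, also where \<open>x\<close> or
  \<open>y\<close> vanishes.\<close>

definition grushin_poly ::
  "nat \<Rightarrow> nat \<Rightarrow> nat \<Rightarrow> real \<Rightarrow> real \<Rightarrow> ('a::euclidean_space \<Rightarrow> 'b::{real_normed_field, euclidean_space})
    \<Rightarrow> ('c::euclidean_space \<Rightarrow> 'b) \<Rightarrow> 'a \<times> 'c \<Rightarrow> 'b" where
  "grushin_poly \<alpha> N j a b H1 H2 = (\<lambda>(x, y). \<Sum>s\<le>N. grushin_coeff \<alpha> N j a b s *\<^sub>R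
     ((norm x ^ (2 * ((\<alpha> + 1) * s)) *\<^sub>R H1 x) * (norm y ^ (2 * (N - s)) *\<^sub>R H2 y)))"

lemma polynomial_function_grushin_poly:
  assumes "polynomial_function H1" "polynomial_function H2"
  shows "polynomial_function (grushin_poly \<alpha> N j a b H1 H2)"
proof -
  have fst: "polynomial_function (\<lambda>z::'a \<times> 'c. norm (fst z) ^ (2 * p) *\<^sub>R H1 (fst z))" for p
    using polynomial_function_compose[OF polynomial_function_bounded_linear[OF bounded_linear_fst]
        polynomial_function_mult[OF polynomial_function_norm_power[of p] assms(1)]]
    by (simp add: o_def)
  have snd: "polynomial_function (\<lambda>z::'a \<times> 'c. norm (snd z) ^ (2 * p) *\<^sub>R H2 (snd z))" for p
    using polynomial_function_compose[OF polynomial_function_bounded_linear[OF bounded_linear_snd]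
        polynomial_function_mult[OF polynomial_function_norm_power[of p] assms(2)]]
    by (simp add: o_def)
  show ?thesis
    unfolding grushin_poly_def case_prod_beta
    by (intro polynomial_function_sum polynomial_function_cmul polynomial_function_times fst snd)
       auto
qed

text \<open>With \<open>y\<close> counted with weight \<open>\<alpha> + 1\<close>, raising
  \<open>s\<close> by one moves the weight \<open>2 * (\<alpha> + 1)\<close> from the
  \<open>y\<close>-factor to the \<open>x\<close>-factor, so all terms have the same weight
  \<open>k\<close>.\<close>

lemma grushin_homogeneous_grushin_poly:
  assumes hom1: "\<And>c x. H1 (c *\<^sub>R x) = c ^ l *\<^sub>R H1 x"
    and hom2: "\<And>c y. H2 (c *\<^sub>R y) = c ^ j *\<^sub>R H2 y"
    and k: "k = l + j * (\<alpha> + 1) + 2 * (\<alpha> + 1) * N"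
  shows "grushin_homogeneous \<alpha> k (grushin_poly \<alpha> N j a b H1 H2)"
  unfolding grushin_homogeneous_def
proof (intro allI impI)
  fix c :: real and x :: 'a and y :: 'c
  assume c: "c > 0"
  have exponent: "c ^ (2 * ((\<alpha> + 1) * s)) * c ^ l *
      ((c ^ (\<alpha> + 1)) ^ (2 * (N - s)) * (c ^ (\<alpha> + 1)) ^ j) = c ^ k"
    if "s \<le> N" for s
  proof -
    have "2 * ((\<alpha> + 1) * s) + l + ((\<alpha> + 1) * (2 * (N - s)) + (\<alpha> + 1) * j) =
        l + j * (\<alpha> + 1) + 2 * (\<alpha> + 1) * (s + (N - s))"
      by (simp only: distrib_left distrib_right mult_1_left mult_1_right mult_ac add_ac)
    also have "s + (N - s) = N"
      using that by simp
    finally show ?thesis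
      by (simp only: k power_add [symmetric] power_mult [symmetric])
  qed
  have summand: "(norm (c *\<^sub>R x) ^ (2 * ((\<alpha> + 1) * s)) *\<^sub>R H1 (c *\<^sub>R x)) *
      (norm (c ^ (\<alpha> + 1) *\<^sub>R y) ^ (2 * (N - s)) *\<^sub>R H2 (c ^ (\<alpha> + 1) *\<^sub>R y)) =
      c ^ k *\<^sub>R ((norm x ^ (2 * ((\<alpha> + 1) * s)) *\<^sub>R H1 x) * (norm y ^ (2 * (N - s)) *\<^sub>R H2 y))"
    if "s \<le> N" for s
    unfolding exponent[OF that, symmetric] using c
    by (simp only: hom1 hom2 norm_scaleR abs_of_pos zero_less_power power_mult_distrib
          mult_scaleR_left mult_scaleR_right scaleR_scaleR mult_ac)
  show "grushin_poly \<alpha> N j a b H1 H2 (c *\<^sub>R x, c ^ (\<alpha> + 1) *\<^sub>R y) =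
      c ^ k *\<^sub>R grushin_poly \<alpha> N j a b H1 H2 (x, y)"
    unfolding grushin_poly_def case_prod_conv scaleR_sum_right
    by (intro sum.cong refl) (simp only: summand atMost_iff, rule scaleR_left_commute)
qed

text \<open>The alternating sign gives the minus; the exponent of \<open>real \<alpha> + 1\<close>
  drops by two, which is made up for by the square that the \<open>x\<close>-Laplacian
  contributes.\<close>

lemma grushin_coeff_Suc:
  assumes "s < N"
  shows "grushin_coeff \<alpha> N j a b (Suc s) * ((real \<alpha> + 1)\<^sup>2 * (real (Suc s) * (real (Suc s) + a))) =
    - (grushin_coeff \<alpha> N j a b s * (real (N - s) * (real (N - s) + b)))"
proof -
  have e: "(real \<alpha> + 1) ^ (2 * (N - s) + j) =
      (real \<alpha> + 1) ^ (2 * (N - Suc s) + j) * (real \<alpha> + 1)\<^sup>2"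
  proof -
    have "2 * (N - s) + j = 2 * (N - Suc s) + j + 2"
      using assms by simp
    then show ?thesis
      by (simp only: power_add)
  qed
  have "grushin_coeff \<alpha> N j a b (Suc s) * ((real \<alpha> + 1)\<^sup>2 * (real (Suc s) * (real (Suc s) + a))) =
    - ((- 1) ^ s * ((real \<alpha> + 1) ^ (2 * (N - Suc s) + j) * (real \<alpha> + 1)\<^sup>2) *
      (jacobi_coeff N a b (Suc s) * (real (Suc s) * (real (Suc s) + a))))"
    unfolding grushin_coeff_def by (simp only: power_Suc mult_ac mult_minus_left mult_minus_right mult_1_left)
  then show ?thesis
    unfolding jacobi_coeff_Suc[OF assms] e[symmetric] grushin_coeff_def by (simp only: mult_ac)
qed

section \<open>Cancellation under the Grushin operator\<close>

lemma grushin_harmonic_grushin_poly: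
  fixes H1 :: "'a::euclidean_space \<Rightarrow> 'b::{real_normed_field, euclidean_space}"
    and H2 :: "'c::euclidean_space \<Rightarrow> 'b"
  assumes H1: "polynomial_function H1" "\<And>c x. H1 (c *\<^sub>R x) = c ^ l *\<^sub>R H1 x" "\<And>x. laplacian H1 x = 0"
    and H2: "polynomial_function H2" "\<And>c y. H2 (c *\<^sub>R y) = c ^ j *\<^sub>R H2 y" "\<And>y. laplacian H2 y = 0"
    and a: "2 * (real \<alpha> + 1) * a = real DIM('a) - 2 + 2 * real l"
    and b: "2 * b = real DIM('c) - 2 + 2 * real j"
  shows "grushin_harmonic \<alpha> (grushin_poly \<alpha> N j a b H1 H2)"
proof -
  let ?g = "grushin_coeff \<alpha> N j a b"
  have "grushin_laplacian \<alpha> (grushin_poly \<alpha> N j a b H1 H2) (x, y) = 0" for x y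
  proof -
    \<comment> \<open>\<open>T s\<close> is the function shared by the \<open>x\<close>-part of term
      \<open>Suc s\<close> and the \<open>y\<close>-part of term \<open>s\<close>. \<open>F\<close>
      and \<open>G\<close> collect the two parts without \<open>H1 x * H2 y\<close>. Truncated
      subtraction does no harm: \<open>F 0\<close> contains \<open>real 0\<close> and
      \<open>G N\<close> contains \<open>real (N - N)\<close>.\<close>
    define T where "T s = 4 * norm x ^ (2 * \<alpha>) * (norm x ^ (2 * ((\<alpha> + 1) * s)) *
        norm y ^ (2 * (N - Suc s)))" for s
    define F where "F s = ?g s * ((real \<alpha> + 1)\<^sup>2 * (real s * (real s + a))) * T (s - 1)" for s
    define G where "G s = ?g s * (real (N - s) * (real (N - s) + b)) * T s" for s
    have poly1: "polynomial_function (\<lambda>x. norm x ^ (2 * p) *\<^sub>R H1 x)" for p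
      by (intro polynomial_function_mult polynomial_function_norm_power H1)
    have poly2: "polynomial_function (\<lambda>y. norm y ^ (2 * p) *\<^sub>R H2 y)" for p
      by (intro polynomial_function_mult polynomial_function_norm_power H2)
    have xs: "?g s * (2 * real ((\<alpha> + 1) * s) *
          (2 * real ((\<alpha> + 1) * s) + real DIM('a) - 2 + 2 * real l) *
          norm x ^ (2 * ((\<alpha> + 1) * s - 1))) * norm y ^ (2 * (N - s)) = F s" for s
    proof (cases s)
      case (Suc s')
      have "2 * real ((\<alpha> + 1) * s) * (2 * real ((\<alpha> + 1) * s) + real DIM('a) - 2 + 2 * real l) =
          2 * real ((\<alpha> + 1) * s) * (2 * real ((\<alpha> + 1) * s) + 2 * (real \<alpha> + 1) * a)"
        unfolding a by (simp add: algebra_simps)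
      also have "\<dots> = 4 * ((real \<alpha> + 1)\<^sup>2 * (real s * (real s + a)))"
        by (simp add: power2_eq_square algebra_simps)
      finally have coeff: "2 * real ((\<alpha> + 1) * s) *
          (2 * real ((\<alpha> + 1) * s) + real DIM('a) - 2 + 2 * real l) =
          4 * ((real \<alpha> + 1)\<^sup>2 * (real s * (real s + a)))" .
      \<comment> \<open>Two derivatives in \<open>x\<close> leave exactly the weight
        \<open>norm x ^ (2 * \<alpha>)\<close> by which the operator multiplies the
        \<open>y\<close>-Laplacian.\<close>
      have exponent: "2 * ((\<alpha> + 1) * s - 1) = 2 * \<alpha> + 2 * ((\<alpha> + 1) * (s - 1))"
        and s: "Suc (s - 1) = s"
        by (simp_all add: Suc)
      show ?thesis
        unfolding coeff exponent F_def T_def s by (simp only: power_add mult_ac)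
    qed (simp add: F_def)
    have ys: "norm x ^ (2 * \<alpha>) * (?g s * norm x ^ (2 * ((\<alpha> + 1) * s)) *
          (2 * real (N - s) * (2 * real (N - s) + real DIM('c) - 2 + 2 * real j) *
          norm y ^ (2 * (N - s - 1)))) = G s" for s
    proof -
      have "2 * real (N - s) * (2 * real (N - s) + real DIM('c) - 2 + 2 * real j) =
          2 * real (N - s) * (2 * real (N - s) + 2 * b)"
        unfolding b by (simp add: algebra_simps)
      also have "\<dots> = 4 * (real (N - s) * (real (N - s) + b))"
        by (simp add: algebra_simps)
      finally have coeff: "2 * real (N - s) * (2 * real (N - s) + real DIM('c) - 2 + 2 * real j) =
          4 * (real (N - s) * (real (N - s) + b))" .
      have exponent: "N - s - 1 = N - Suc s"
        by simp
      show ?thesis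
        unfolding coeff exponent G_def T_def by (simp only: mult_ac)
    qed
    have "laplacian (\<lambda>x. grushin_poly \<alpha> N j a b H1 H2 (x, y)) x =
        (\<Sum>s\<le>N. laplacian (\<lambda>x. ?g s *\<^sub>R ((norm x ^ (2 * ((\<alpha> + 1) * s)) *\<^sub>R H1 x) *
          (norm y ^ (2 * (N - s)) *\<^sub>R H2 y))) x)"
      unfolding grushin_poly_def case_prod_conv
      by (intro laplacian_sum polynomial_function_cmul polynomial_function_times poly1) auto
    also have "\<dots> = (\<Sum>s\<le>N. F s) *\<^sub>R (H1 x * H2 y)"
    proof -
      have "laplacian (\<lambda>x. ?g s *\<^sub>R ((norm x ^ (2 * ((\<alpha> + 1) * s)) *\<^sub>R H1 x) *
          (norm y ^ (2 * (N - s)) *\<^sub>R H2 y))) x = F s *\<^sub>R (H1 x * H2 y)" for s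
      proof -
        \<comment> \<open>For fixed \<open>y\<close> the term is a bounded linear image of its
          \<open>x\<close>-factor, so the Laplacian acts on that factor alone.\<close>
        have "bounded_linear (\<lambda>v. ?g s *\<^sub>R (v * (norm y ^ (2 * (N - s)) *\<^sub>R H2 y)))"
          by (intro bounded_linear_scaleR_right[THEN bounded_linear_compose] bounded_linear_mult_left)
        from laplacian_bounded_linear[OF this poly1[of "(\<alpha> + 1) * s"], of x] show ?thesis
          unfolding xs[symmetric] laplacian_norm_power_harmonic[OF H1]
          by (simp only: mult_scaleR_left mult_scaleR_right scaleR_scaleR mult_ac)
      qed
      then show ?thesis
        by (simp add: scaleR_sum_left)
    qed
    finally have X: "laplacian (\<lambda>x. grushin_poly \<alpha> N j a b H1 H2 (x, y)) x =
        (\<Sum>s\<le>N. F s) *\<^sub>R (H1 x * H2 y)" .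
    have "laplacian (\<lambda>y. grushin_poly \<alpha> N j a b H1 H2 (x, y)) y =
        (\<Sum>s\<le>N. laplacian (\<lambda>y. ?g s *\<^sub>R ((norm x ^ (2 * ((\<alpha> + 1) * s)) *\<^sub>R H1 x) *
          (norm y ^ (2 * (N - s)) *\<^sub>R H2 y))) y)"
      unfolding grushin_poly_def case_prod_conv
      by (intro laplacian_sum polynomial_function_cmul polynomial_function_times poly2) auto
    then have "norm x ^ (2 * \<alpha>) *\<^sub>R laplacian (\<lambda>y. grushin_poly \<alpha> N j a b H1 H2 (x, y)) y =
        (\<Sum>s\<le>N. norm x ^ (2 * \<alpha>) *\<^sub>R laplacian (\<lambda>y. ?g s *\<^sub>R
          ((norm x ^ (2 * ((\<alpha> + 1) * s)) *\<^sub>R H1 x) * (norm y ^ (2 * (N - s)) *\<^sub>R H2 y))) y)"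
      by (simp only: scaleR_sum_right)
    also have "\<dots> = (\<Sum>s\<le>N. G s) *\<^sub>R (H1 x * H2 y)"
    proof -
      have "norm x ^ (2 * \<alpha>) *\<^sub>R laplacian (\<lambda>y. ?g s *\<^sub>R ((norm x ^ (2 * ((\<alpha> + 1) * s)) *\<^sub>R H1 x) *
          (norm y ^ (2 * (N - s)) *\<^sub>R H2 y))) y = G s *\<^sub>R (H1 x * H2 y)" for s
      proof -
        have "bounded_linear (\<lambda>v. ?g s *\<^sub>R ((norm x ^ (2 * ((\<alpha> + 1) * s)) *\<^sub>R H1 x) * v))"
          by (intro bounded_linear_scaleR_right[THEN bounded_linear_compose] bounded_linear_mult_right)
        from laplacian_bounded_linear[OF this poly2[of "N - s"], of y] show ?thesis
          unfolding ys[symmetric] laplacian_norm_power_harmonic[OF H2]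
          by (simp only: mult_scaleR_left mult_scaleR_right scaleR_scaleR mult_ac)
      qed
      then show ?thesis
        by (simp add: scaleR_sum_left)
    qed
    finally have Y: "norm x ^ (2 * \<alpha>) *\<^sub>R laplacian (\<lambda>y. grushin_poly \<alpha> N j a b H1 H2 (x, y)) y =
        (\<Sum>s\<le>N. G s) *\<^sub>R (H1 x * H2 y)" .
    \<comment> \<open>The sums cancel after a shift by one index: \<open>F 0\<close> is dropped here
      and \<open>G N\<close> is added below, both being zero.\<close>
    have "(\<Sum>s\<le>N. F s) = (\<Sum>s<N. F (Suc s))"
      by (simp add: sum.atMost_shift F_def)
    also have "\<dots> = (\<Sum>s<N. - G s)"
    proof (intro sum.cong refl)
      fix s assume "s \<in> {..<N}"
      then show "F (Suc s) = - G s"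
        unfolding F_def G_def by (subst grushin_coeff_Suc) auto
    qed
    also have "\<dots> = - (\<Sum>s\<le>N. G s)"
      by (simp add: lessThan_Suc_atMost [symmetric] sum_negf G_def)
    finally show ?thesis
      by (simp add: grushin_laplacian_def X Y)
  qed
  then show ?thesis
    by (simp add: grushin_harmonic_def)
qed

section \<open>Values in polar coordinates\<close>

text \<open>Homogeneity moves \<open>H1\<close> and \<open>H2\<close> to the unit vectors, and each
  term is then matched with one term of the Jacobi polynomial. There is no division by a norm, so
  points with \<open>x = 0\<close> or \<open>y = 0\<close> are covered for any choice of the
  undetermined angles.\<close>

lemma grushin_poly_polar:
  assumes polar: "grushin_polar \<alpha> x y \<rho> \<phi> \<omega>1 \<omega>2"
    and hom1: "\<And>c x. H1 (c *\<^sub>R x) = c ^ l *\<^sub>R H1 x" and hom2: "\<And>c y. H2 (c *\<^sub>R y) = c ^ j *\<^sub>R H2 y"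
    and k: "k = l + j * (\<alpha> + 1) + 2 * (\<alpha> + 1) * N"
  shows "grushin_poly \<alpha> N j \<mu> (\<gamma> - 1) H1 H2 (x, y) =
    (\<rho> ^ k * grushin_h \<alpha> N l j \<mu> \<gamma> \<phi>) *\<^sub>R (H1 \<omega>1 * H2 \<omega>2)"
proof -
  define S where "S = root (\<alpha> + 1) (sin \<phi>)"
  have \<phi>: "0 \<le> \<phi>" "\<phi> \<le> pi / 2" and nx: "norm x = \<rho> * S"
    and ny: "(real \<alpha> + 1) * norm y = \<rho> ^ (\<alpha> + 1) * cos \<phi>"
    and xy: "x = norm x *\<^sub>R \<omega>1" "y = norm y *\<^sub>R \<omega>2"
    using polar by (auto simp: grushin_polar_def S_def)
  have "sin \<phi> \<ge> 0"
    using \<phi> by (intro sin_ge_zero) auto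
  then have S: "S ^ (\<alpha> + 1) = sin \<phi>"
    unfolding S_def by (intro real_root_pow_pos2) auto
  have t1: "(cos (2 * \<phi>) - 1) / 2 = - ((sin \<phi>)\<^sup>2)"
    by (simp add: cos_double_sin)
  have t2: "(cos (2 * \<phi>) + 1) / 2 = (cos \<phi>)\<^sup>2"
    by (simp add: cos_double_cos)
  have h1: "H1 x = norm x ^ l *\<^sub>R H1 \<omega>1"
    by (subst xy(1)) (rule hom1)
  have h2: "H2 y = norm y ^ j *\<^sub>R H2 \<omega>2"
    by (subst xy(2)) (rule hom2)
  have summand: "grushin_coeff \<alpha> N j \<mu> (\<gamma> - 1) s * (norm x ^ (2 * ((\<alpha> + 1) * s)) * norm x ^ l) *
      (norm y ^ (2 * (N - s)) * norm y ^ j) =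
      \<rho> ^ k * (cos \<phi> ^ j * S ^ l * (jacobi_coeff N \<mu> (\<gamma> - 1) s *
        ((cos (2 * \<phi>) - 1) / 2) ^ s * ((cos (2 * \<phi>) + 1) / 2) ^ (N - s)))" if "s \<le> N" for s
  proof -
    have kx: "k = (2 * ((\<alpha> + 1) * s) + l) + (\<alpha> + 1) * (2 * (N - s) + j)"
    proof -
      have "(2 * ((\<alpha> + 1) * s) + l) + (\<alpha> + 1) * (2 * (N - s) + j) =
          l + j * (\<alpha> + 1) + 2 * (\<alpha> + 1) * (s + (N - s))"
        by (simp only: distrib_left distrib_right mult_1_left mult_1_right mult_ac add_ac)
      then show ?thesis
        using that by (simp add: k)
    qed
    have X: "norm x ^ (2 * ((\<alpha> + 1) * s)) * norm x ^ l =
        \<rho> ^ (2 * ((\<alpha> + 1) * s) + l) * (((sin \<phi>)\<^sup>2) ^ s * S ^ l)"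
    proof -
      have "S ^ (2 * ((\<alpha> + 1) * s)) = ((sin \<phi>)\<^sup>2) ^ s"
        unfolding S[symmetric] by (simp only: power_mult [symmetric] mult_ac)
      then show ?thesis
        by (simp only: nx power_mult_distrib power_add mult_ac)
    qed
    \<comment> \<open>The power of \<open>real \<alpha> + 1\<close> in the coefficient is used up
      here, because \<open>(real \<alpha> + 1) * norm y\<close> is the quantity with a clean polar
      form.\<close>
    have Y: "(real \<alpha> + 1) ^ (2 * (N - s) + j) * (norm y ^ (2 * (N - s)) * norm y ^ j) =
        \<rho> ^ ((\<alpha> + 1) * (2 * (N - s) + j)) * (((cos \<phi>)\<^sup>2) ^ (N - s) * cos \<phi> ^ j)"
    proof -
      have "(real \<alpha> + 1) ^ (2 * (N - s) + j) * (norm y ^ (2 * (N - s)) * norm y ^ j) =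
          ((real \<alpha> + 1) * norm y) ^ (2 * (N - s) + j)"
        by (simp only: power_mult_distrib power_add mult_ac)
      also have "\<dots> = \<rho> ^ ((\<alpha> + 1) * (2 * (N - s) + j)) * cos \<phi> ^ (2 * (N - s) + j)"
        by (simp only: ny power_mult_distrib power_mult)
      finally show ?thesis
        by (simp only: power_add power_mult)
    qed
    have "grushin_coeff \<alpha> N j \<mu> (\<gamma> - 1) s * (norm x ^ (2 * ((\<alpha> + 1) * s)) * norm x ^ l) *
        (norm y ^ (2 * (N - s)) * norm y ^ j) = jacobi_coeff N \<mu> (\<gamma> - 1) s * (- 1) ^ s *
        (norm x ^ (2 * ((\<alpha> + 1) * s)) * norm x ^ l) *
        ((real \<alpha> + 1) ^ (2 * (N - s) + j) * (norm y ^ (2 * (N - s)) * norm y ^ j))"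
      by (simp only: grushin_coeff_def mult_ac)
    also have "\<dots> = \<rho> ^ k * (cos \<phi> ^ j * S ^ l * (jacobi_coeff N \<mu> (\<gamma> - 1) s *
        ((- 1) ^ s * ((sin \<phi>)\<^sup>2) ^ s) * ((cos \<phi>)\<^sup>2) ^ (N - s)))"
      unfolding X Y kx by (simp only: power_add mult_ac)
    finally show ?thesis
      unfolding t1 t2 power_mult_distrib [symmetric] by simp
  qed
  have "grushin_poly \<alpha> N j \<mu> (\<gamma> - 1) H1 H2 (x, y) = (\<Sum>s\<le>N.
      (grushin_coeff \<alpha> N j \<mu> (\<gamma> - 1) s * (norm x ^ (2 * ((\<alpha> + 1) * s)) * norm x ^ l) *
      (norm y ^ (2 * (N - s)) * norm y ^ j)) *\<^sub>R (H1 \<omega>1 * H2 \<omega>2))"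
    unfolding grushin_poly_def case_prod_conv h1 h2
    by (simp only: mult_scaleR_left mult_scaleR_right scaleR_scaleR mult_ac)
  also have "\<dots> = (\<Sum>s\<le>N. (\<rho> ^ k * (cos \<phi> ^ j * S ^ l * (jacobi_coeff N \<mu> (\<gamma> - 1) s *
        ((cos (2 * \<phi>) - 1) / 2) ^ s * ((cos (2 * \<phi>) + 1) / 2) ^ (N - s)))) *\<^sub>R (H1 \<omega>1 * H2 \<omega>2))"
    by (intro sum.cong refl) (simp only: summand atMost_iff)
  finally show ?thesis
    by (simp only: grushin_h_def S_def jacobi_poly_def jacobi_coeff_def sum_distrib_left
          scaleR_sum_left)
qed

text \<open>Polar coordinates are not unique where \<open>x\<close> or \<open>y\<close> vanishes.
  The existential thus also says that the formula is independent of their choice;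
  \<open>grushin_polar_exists\<close> makes \<open>u\<close> unique.\<close>

theorem theorem3p1:
  fixes \<alpha> k l j N :: nat and \<gamma> \<mu> :: real
    and Y1 :: "real ^ 'n \<Rightarrow> 'b::{real_normed_field, euclidean_space}"
    and Y2 :: "real ^ 'm \<Rightarrow> 'b"
  assumes "CARD('n) \<ge> 2" and "CARD('m) \<ge> 2"
    and "spherical_harmonic l Y1" and "spherical_harmonic j Y2"
    and "real N = (real k - real l - real j * (real \<alpha> + 1)) / (2 * (real \<alpha> + 1))"
    and "\<gamma> = real j + real CARD('m) / 2"
    and "\<mu> = (real CARD('n) - 2 + 2 * real l) / (2 * (real \<alpha> + 1))"
  shows "\<exists>u :: (real ^ 'n) \<times> (real ^ 'm) \<Rightarrow> 'b.
    (\<forall>x y \<rho> \<phi> \<omega>1 \<omega>2. grushin_polar \<alpha> x y \<rho> \<phi> \<omega>1 \<omega>2 \<longrightarrow>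
       u (x, y) = (\<rho> ^ k * grushin_h \<alpha> N l j \<mu> \<gamma> \<phi>) *\<^sub>R (Y1 \<omega>1 * Y2 \<omega>2)) \<and>
    polynomial_function u \<and> grushin_homogeneous \<alpha> k u \<and> grushin_harmonic \<alpha> u"
proof -
  obtain H1 where H1: "polynomial_function H1" "\<And>c x. H1 (c *\<^sub>R x) = c ^ l *\<^sub>R H1 x"
      "\<And>x. laplacian H1 x = 0" and Y1: "\<And>\<omega>. \<omega> \<in> sphere 0 1 \<Longrightarrow> Y1 \<omega> = H1 \<omega>"
    using assms(3) unfolding spherical_harmonic_def by blast
  obtain H2 where H2: "polynomial_function H2" "\<And>c x. H2 (c *\<^sub>R x) = c ^ j *\<^sub>R H2 x"
      "\<And>x. laplacian H2 x = 0" and Y2: "\<And>\<omega>. \<omega> \<in> sphere 0 1 \<Longrightarrow> Y2 \<omega> = H2 \<omega>"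
    using assms(4) unfolding spherical_harmonic_def by blast
  \<comment> \<open>Clearing the denominator in the reals and returning to \<open>nat\<close> avoids
    truncated subtraction in \<open>k - l - j * (\<alpha> + 1)\<close>.\<close>
  have "real k = real l + real j * (real \<alpha> + 1) + 2 * (real \<alpha> + 1) * real N"
    unfolding assms(5) by simp
  also have "\<dots> = real (l + j * (\<alpha> + 1) + 2 * (\<alpha> + 1) * N)"
    by (simp add: algebra_simps)
  finally have k: "k = l + j * (\<alpha> + 1) + 2 * (\<alpha> + 1) * N"
    by (simp only: of_nat_eq_iff)
  let ?u = "grushin_poly \<alpha> N j \<mu> (\<gamma> - 1) H1 H2"
  have "?u (x, y) = (\<rho> ^ k * grushin_h \<alpha> N l j \<mu> \<gamma> \<phi>) *\<^sub>R (Y1 \<omega>1 * Y2 \<omega>2)"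
    if "grushin_polar \<alpha> x y \<rho> \<phi> \<omega>1 \<omega>2" for x y \<rho> \<phi> \<omega>1 \<omega>2
  proof -
    have "\<omega>1 \<in> sphere 0 1" "\<omega>2 \<in> sphere 0 1"
      using that by (auto simp: grushin_polar_def)
    with grushin_poly_polar[OF that H1(2) H2(2) k] show ?thesis
      by (simp only: Y1 Y2)
  qed
  moreover have "grushin_harmonic \<alpha> ?u"
    \<comment> \<open>The definitions of \<open>\<mu>\<close> and \<open>\<gamma>\<close> are
      exactly the two conditions on \<open>a = \<mu>\<close> and
      \<open>b = \<gamma> - 1\<close>.\<close>
    by (rule grushin_harmonic_grushin_poly[OF H1 H2]) (simp_all add: assms(6,7))
  ultimately show ?thesis
    using polynomial_function_grushin_poly[OF H1(1) H2(1)]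
      grushin_homogeneous_grushin_poly[OF H1(2) H2(2) k] by blast
qed

end
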